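(* Consider a point-to-point channel with in-block memory, block length $L$, and feedback, given by a block channel law $P(y^L,\tilde y^L\|x^L)$. The maximum in the capacity expression $$C=\max_{P_{\mathbf{A}^L}} I(\mathbf{A}^L;Y^L)/L$$ over distributions of the block code function $\mathbf{A}^L$, where the joint distribution of $(\mathbf{A}^L,X^L,Y^L,\tilde Y^L)$ factors as $P(\mathbf{a}^L)\,1(x^L\|\mathbf{a}^L,0\tilde y^{L-1})\,P(y^L,\tilde y^L\|x^L)$, is achieved by a $P_{\mathbf{A}^L}$ for which the support size $|\mathrm{supp}(P_{\mathbf{A}^L})|$ is at most $$\min\left(\left|\mathcal{Y}^L\right|,\ |\mathcal{X}_1|+\sum_{i=2}^L\left|\mathcal{X}^{i-1}\right|\cdot\left|\tilde{\mathcal{Y}}^{i-1}\right|\cdot\left(|\mathcal{X}_i|-1\right)\right).$$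
   Context: The input $X_i$, receiver output $Y_i$ and feedback $\tilde Y_i$ at position $i\in\{1,\dots,L\}$ of a block take values in alphabets $\mathcal{X}_i,\mathcal{Y}_i,\tilde{\mathcal{Y}}_i$; $\mathcal{X}^{i}=\mathcal{X}_1\times\cdots\times\mathcal{X}_i$ and similarly for $\mathcal{Y}^i,\tilde{\mathcal{Y}}^i$. A block code function $\mathbf{a}^L=(\mathbf{a}_1,\dots,\mathbf{a}_L)$ is a tuple of functions $\mathbf{a}_i:\tilde{\mathcal{Y}}^{i-1}\to\mathcal{X}_i$ ($\mathbf{a}_1$ is an element of $\mathcal{X}_1$); $\mathbf{A}^L$ is a random such tuple. $1(x^L\|\mathbf{a}^L,0\tilde y^{L-1})$ is $1$ if $x_i=\mathbf{a}_i(\tilde y^{i-1})$ for all $i=1,\dots,L$, else $0$. The block channel law is $P(y^L,\tilde y^L\|x^L)=\prod_{i=1}^L P(y_i,\tilde y_i\mid y^{i-1},\tilde y^{i-1},x^i)$ for given conditional distributions $P(y_i,\tilde y_i\mid y^{i-1},\tilde y^{i-1},x^i)$. The displayed maximum is the capacity, in bits per channel use, of the channel that has this law in each block of length $L$ and is memoryless across successive blocks, where the encoder chooses each input as a function of its message and all past feedback symbols. Logarithms are to base 2. *)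

theory Defs
  imports "HOL-Probability.Probability"
begin

text \<open>
  Positions of a block are 1, ..., L, and the alphabets may differ from position to position:
  they are families \<open>X\<close>, \<open>Y\<close>, \<open>Z\<close> of finite sets, \<open>Z\<close> being the feedback alphabets.
  A word of length \<open>n\<close> is an extensional function on \<open>{1..n}\<close>; the empty word is the only
  element of \<open>words A 0\<close>.
\<close>

definition words :: "(nat \<Rightarrow> 'a set) \<Rightarrow> nat \<Rightarrow> (nat \<Rightarrow> 'a) set" where
  "words A n = (\<Pi>\<^sub>E i\<in>{1..n}. A i)"

definition prefix :: "nat \<Rightarrow> (nat \<Rightarrow> 'a) \<Rightarrow> nat \<Rightarrow> 'a" where
  "prefix n w = restrict w {1..n}"

text \<open>
  The functions are extensional on the feedback words of length \<open>i - 1\<close>, so that distinct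
  elements are distinct tuples of functions, and component 1, whose only argument is the empty
  word, amounts to an element of \<open>X 1\<close>.
\<close>

definition code_functions ::
  "nat \<Rightarrow> (nat \<Rightarrow> 'x set) \<Rightarrow> (nat \<Rightarrow> 'z set) \<Rightarrow> (nat \<Rightarrow> (nat \<Rightarrow> 'z) \<Rightarrow> 'x) set" where
  "code_functions L X Z = (\<Pi>\<^sub>E i\<in>{1..L}. words Z (i - 1) \<rightarrow>\<^sub>E X i)"

definition code_dists ::
  "nat \<Rightarrow> (nat \<Rightarrow> 'x set) \<Rightarrow> (nat \<Rightarrow> 'z set) \<Rightarrow> (nat \<Rightarrow> (nat \<Rightarrow> 'z) \<Rightarrow> 'x) pmf set" where
  "code_dists L X Z = {P. set_pmf P \<subseteq> code_functions L X Z}"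

text \<open>
  \<open>W i y z x\<close> is the conditional distribution of the output and feedback at position \<open>i\<close>, given
  the earlier outputs \<open>y\<close>, the earlier feedback \<open>z\<close> and the inputs \<open>x\<close> up to position \<open>i\<close>.
\<close>

type_synonym ('x, 'y, 'z) kernel =
  "nat \<Rightarrow> (nat \<Rightarrow> 'y) \<Rightarrow> (nat \<Rightarrow> 'z) \<Rightarrow> (nat \<Rightarrow> 'x) \<Rightarrow> ('y \<times> 'z) pmf"

definition channel_kernel ::
  "nat \<Rightarrow> (nat \<Rightarrow> 'x set) \<Rightarrow> (nat \<Rightarrow> 'y set) \<Rightarrow> (nat \<Rightarrow> 'z set) \<Rightarrow> ('x, 'y, 'z) kernel \<Rightarrow> bool" where
  "channel_kernel L X Y Z W \<longleftrightarrow>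
     (\<forall>i\<in>{1..L}. \<forall>y\<in>words Y (i - 1). \<forall>z\<in>words Z (i - 1). \<forall>x\<in>words X i.
        set_pmf (W i y z x) \<subseteq> Y i \<times> Z i)"

definition block_law ::
  "nat \<Rightarrow> ('x, 'y, 'z) kernel \<Rightarrow> (nat \<Rightarrow> 'x) \<Rightarrow> (nat \<Rightarrow> 'y) \<Rightarrow> (nat \<Rightarrow> 'z) \<Rightarrow> real" where
  "block_law L W x y z =
     (\<Prod>i=1..L. pmf (W i (prefix (i - 1) y) (prefix (i - 1) z) (prefix i x)) (y i, z i))"

definition consistent ::
  "nat \<Rightarrow> (nat \<Rightarrow> 'x) \<Rightarrow> (nat \<Rightarrow> (nat \<Rightarrow> 'z) \<Rightarrow> 'x) \<Rightarrow> (nat \<Rightarrow> 'z) \<Rightarrow> bool" where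
  "consistent L x a z \<longleftrightarrow> (\<forall>i\<in>{1..L}. x i = a i (prefix (i - 1) z))"

definition joint_law ::
  "nat \<Rightarrow> (nat \<Rightarrow> 'x set) \<Rightarrow> (nat \<Rightarrow> 'y set) \<Rightarrow> (nat \<Rightarrow> 'z set) \<Rightarrow> ('x, 'y, 'z) kernel
    \<Rightarrow> (nat \<Rightarrow> (nat \<Rightarrow> 'z) \<Rightarrow> 'x) pmf
    \<Rightarrow> ((nat \<Rightarrow> (nat \<Rightarrow> 'z) \<Rightarrow> 'x) \<times> (nat \<Rightarrow> 'x) \<times> (nat \<Rightarrow> 'y) \<times> (nat \<Rightarrow> 'z)) measure" where
  "joint_law L X Y Z W P =
     point_measure (code_functions L X Z \<times> words X L \<times> words Y L \<times> words Z L)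
       (\<lambda>(a, x, y, z). ennreal (pmf P a * of_bool (consistent L x a z) * block_law L W x y z))"

definition code_information ::
  "nat \<Rightarrow> (nat \<Rightarrow> 'x set) \<Rightarrow> (nat \<Rightarrow> 'y set) \<Rightarrow> (nat \<Rightarrow> 'z set) \<Rightarrow> ('x, 'y, 'z) kernel
    \<Rightarrow> (nat \<Rightarrow> (nat \<Rightarrow> 'z) \<Rightarrow> 'x) pmf \<Rightarrow> real" where
  "code_information L X Y Z W P =
     prob_space.mutual_information (joint_law L X Y Z W P) 2
       (count_space (code_functions L X Z)) (count_space (words Y L))
       (\<lambda>(a, x, y, z). a) (\<lambda>(a, x, y, z). y)"

definition capacity_expression ::
  "nat \<Rightarrow> (nat \<Rightarrow> 'x set) \<Rightarrow> (nat \<Rightarrow> 'y set) \<Rightarrow> (nat \<Rightarrow> 'z set) \<Rightarrow> ('x, 'y, 'z) kernel \<Rightarrow> real" where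
  "capacity_expression L X Y Z W =
     (SUP P\<in>code_dists L X Z. code_information L X Y Z W P / real L)"

end

theory Submission
  imports Defs "HOL-Real_Asymp.Real_Asymp"
begin

text \<open>
  For fixed output distribution the mutual information is linear in the code distribution. From a
  maximiser one can therefore move along any direction that lies in the kernel of the matrix of
  output laws, in the sense in which the linear part does not decrease, until a code function drops
  out of the support. So a maximiser of minimal support has linearly independent output laws, and
  the size of its support is at most the number of linear functionals that determine the output
  distribution. Two such families are the output probabilities themselves, and the causally
  conditioned input probabilities \<open>P(x\<^sup>i \<parallel> 0 z\<^sup>i\<^sup>-\<^sup>1)\<close> with one value of the last input left out.
\<close>

section \<open>Homogeneous linear systems\<close>

text \<open>Gaussian elimination: each round of the induction on \<open>K\<close> spends one
  equation and at most one unknown, so with fewer equations than unknowns one stays free.\<close>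

lemma underdetermined_system:
  fixes \<phi> :: "'k \<Rightarrow> 'a \<Rightarrow> real"
  assumes "finite K" "finite S" "card K < card S"
  obtains c where "\<exists>a\<in>S. c a \<noteq> 0" "\<And>k. k \<in> K \<Longrightarrow> (\<Sum>a\<in>S. c a * \<phi> k a) = 0"
  using assms
proof (induction K arbitrary: S \<phi> thesis rule: finite_induct)
  case empty
  then have "S \<noteq> {}" by auto
  then show ?case using empty(1)[of "\<lambda>_. 1"] by auto
next
  case (insert k K)
  show ?case
  proof (cases "\<forall>a\<in>S. \<phi> k a = 0")
    case True
    have "card K < card S" using insert by simp
    with insert.IH[of S \<phi>] insert.prems(2) obtain c where
      "\<exists>a\<in>S. c a \<noteq> 0" "\<And>k. k \<in> K \<Longrightarrow> (\<Sum>a\<in>S. c a * \<phi> k a) = 0"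
      by blast
    then show ?thesis using True by (intro insert.prems(1)[of c]) auto
  next
    case False
    then obtain b where b: "b \<in> S" "\<phi> k b \<noteq> 0" by blast
    \<comment> \<open>Equation \<open>k\<close> has the pivot \<open>b\<close>; subtracting a
      multiple of it from each row makes the coefficient of \<open>b\<close> vanish there.\<close>
    define \<psi> where "\<psi> j a = \<phi> j a - \<phi> k a / \<phi> k b * \<phi> j b" for j a
    have "card K < card (S - {b})" using insert b by simp
    with insert.IH[of "S - {b}" \<psi>] insert.prems(2) obtain c where
      c: "\<exists>a\<in>S - {b}. c a \<noteq> 0" "\<And>k. k \<in> K \<Longrightarrow> (\<Sum>a\<in>S - {b}. c a * \<psi> k a) = 0"
      by blast
    \<comment> \<open>Back substitution: the value \<open>- d\<close> at \<open>b\<close> satisfies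
      equation \<open>k\<close> whatever the other values are.\<close>
    define d where "d = (\<Sum>a\<in>S - {b}. c a * \<phi> k a) / \<phi> k b"
    define c' where "c' = c(b := - d)"
    have sum: "(\<Sum>a\<in>S. c' a * \<phi> j a) = (\<Sum>a\<in>S - {b}. c a * \<phi> j a) - d * \<phi> j b" for j
    proof -
      have "(\<Sum>a\<in>S. c' a * \<phi> j a) = c' b * \<phi> j b + (\<Sum>a\<in>S - {b}. c' a * \<phi> j a)"
        using b insert.prems(2) by (simp add: sum.remove)
      also have "(\<Sum>a\<in>S - {b}. c' a * \<phi> j a) = (\<Sum>a\<in>S - {b}. c a * \<phi> j a)"
        by (intro sum.cong) (auto simp: c'_def)
      finally show ?thesis by (simp add: c'_def)
    qed
    show ?thesis
    proof (rule insert.prems(1))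
      show "\<exists>a\<in>S. c' a \<noteq> 0" using c(1) by (auto simp: c'_def)
    next
      fix j assume j: "j \<in> insert k K"
      show "(\<Sum>a\<in>S. c' a * \<phi> j a) = 0"
      proof (cases "j = k")
        case True
        then show ?thesis using b by (simp add: sum d_def)
      next
        case False
        then have "(\<Sum>a\<in>S - {b}. c a * \<psi> j a) = 0" using c(2) j by auto
        moreover have "(\<Sum>a\<in>S - {b}. c a * \<psi> j a) = (\<Sum>a\<in>S - {b}. c a * \<phi> j a) - d * \<phi> j b"
        proof -
          have "c a * \<psi> j a = c a * \<phi> j a - c a * \<phi> k a * (\<phi> j b / \<phi> k b)" for a
            by (simp add: \<psi>_def algebra_simps)
          then have "(\<Sum>a\<in>S - {b}. c a * \<psi> j a) =
            (\<Sum>a\<in>S - {b}. c a * \<phi> j a) - (\<Sum>a\<in>S - {b}. c a * \<phi> k a) * (\<phi> j b / \<phi> k b)"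
            by (simp only: sum_subtractf sum_distrib_right)
          then show ?thesis by (simp add: d_def)
        qed
        ultimately show ?thesis by (simp add: sum)
      qed
    qed
  qed
qed

section \<open>The information functional on weight vectors\<close>

definition xlog :: "real \<Rightarrow> real" where
  "xlog x = x * log 2 x"

text \<open>The only delicate point is 0, where \<open>xlog 0 = 0\<close> agrees with the limit from
  the right, so zero probabilities cause no discontinuity.\<close>

lemma continuous_on_xlog: "continuous_on {0..} xlog"
proof (rule continuous_on_eq_continuous_within[THEN iffD2], rule ballI)
  fix x :: real assume "x \<in> {0..}"
  then consider "x = 0" | "x > 0" by fastforce
  then show "continuous (at x within {0..}) xlog"
  proof cases
    case 1
    have "((\<lambda>x::real. x * log 2 x) \<longlongrightarrow> 0) (at_right 0)" by real_asymp
    then have "(xlog \<longlongrightarrow> xlog 0) (at 0 within {0..})"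
      unfolding at_within_Ici_at_right by (simp add: xlog_def[abs_def])
    then show ?thesis using 1 by (simp add: continuous_within)
  next
    case 2
    then have "isCont xlog x" unfolding xlog_def[abs_def] by (intro continuous_intros) auto
    then show ?thesis by (rule continuous_at_imp_continuous_at_within)
  qed
qed

text \<open>Real functions that vanish outside \<open>A\<close>, rather than a pmf type: they form a
  compact set in the product topology and can be moved along real directions.\<close>

definition weights :: "'a set \<Rightarrow> ('a \<Rightarrow> real) set" where
  "weights A = {p. (\<forall>a\<in>A. 0 \<le> p a) \<and> (\<forall>a. a \<notin> A \<longrightarrow> p a = 0) \<and> sum p A = 1}"

lemma compact_weights:
  assumes "finite A"
  shows "compact (weights A)"
proof -
  let ?B = "\<Pi>\<^sub>E a\<in>UNIV. if a \<in> A then {0..1::real} else {0}"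
  \<comment> \<open>Tychonoff: unit intervals on \<open>A\<close>, and the single point 0 at every
    other coordinate.\<close>
  have "compact ?B"
    using compactin_PiE[of "\<lambda>_. euclidean" UNIV "\<lambda>a. if a \<in> A then {0..1::real} else {0}"]
    by (simp add: euclidean_product_topology)
  moreover have "closed {p :: 'a \<Rightarrow> real. sum p A = 1}"
    by (intro closed_Collect_eq continuous_intros continuous_on_sum continuous_on_product_coordinates)
  moreover have "weights A = ?B \<inter> {p. sum p A = 1}"
  proof -
    have "p a \<le> 1" if "\<forall>a\<in>A. 0 \<le> p a" "sum p A = 1" "a \<in> A" for p :: "'a \<Rightarrow> real" and a
      using member_le_sum[of a A p] that assms by simp
    then show ?thesis by (fastforce simp: weights_def PiE_iff split: if_splits)
  qed
  ultimately show ?thesis by (simp add: compact_Int_closed)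
qed

text \<open>This is H(Y) - H(Y|A) for input weights \<open>p\<close> and channel \<open>V\<close>.
  The first sum is linear in \<open>p\<close>; the second depends on \<open>p\<close> only through
  the output distribution.\<close>

definition information :: "'a set \<Rightarrow> 'b set \<Rightarrow> ('a \<Rightarrow> 'b \<Rightarrow> real) \<Rightarrow> ('a \<Rightarrow> real) \<Rightarrow> real" where
  "information A B V p =
     (\<Sum>a\<in>A. p a * (\<Sum>y\<in>B. xlog (V a y))) - (\<Sum>y\<in>B. xlog (\<Sum>a\<in>A. p a * V a y))"

lemma continuous_on_information:
  assumes "\<And>a y. a \<in> A \<Longrightarrow> y \<in> B \<Longrightarrow> 0 \<le> V a y"
  shows "continuous_on (weights A) (information A B V)"
proof -
  have eval: "continuous_on S (\<lambda>p. p a)" for S :: "('a \<Rightarrow> real) set" and a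
    by (rule continuous_on_subset[OF continuous_on_product_coordinates]) simp
  have "continuous_on (weights A) (\<lambda>p. xlog (\<Sum>a\<in>A. p a * V a y))" if "y \<in> B" for y
    by (rule continuous_on_compose2[OF continuous_on_xlog])
       (auto intro!: continuous_intros eval sum_nonneg mult_nonneg_nonneg assms that simp: weights_def)
  then show ?thesis
    unfolding information_def[abs_def] by (intro continuous_intros eval) auto
qed

section \<open>Maximisers of least support\<close>

text \<open>Compactness gives a maximiser, and one of least support is taken. The last conclusion is
  linear independence of the output laws on that support: a dependency would be a direction in which
  the support shrinks without loss.\<close>

lemma optimal_weights:
  assumes fin: "finite A" and ne: "A \<noteq> {}"
    and nonneg: "\<And>a y. a \<in> A \<Longrightarrow> y \<in> B \<Longrightarrow> 0 \<le> V a y"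
    and total: "\<And>a. a \<in> A \<Longrightarrow> (\<Sum>y\<in>B. V a y) = 1"
  obtains p where "p \<in> weights A"
    "\<forall>q\<in>weights A. information A B V q \<le> information A B V p"
    "\<forall>c. (\<forall>a. p a = 0 \<longrightarrow> c a = 0) \<longrightarrow> (\<forall>y\<in>B. (\<Sum>a\<in>A. c a * V a y) = 0)
       \<longrightarrow> c = (\<lambda>_. 0)"
proof -
  define opt where "opt p \<longleftrightarrow> p \<in> weights A \<and>
    (\<forall>q\<in>weights A. information A B V q \<le> information A B V p)" for p
  obtain a where "a \<in> A" using ne by blast
  then have "(\<lambda>b. if b = a then 1 else 0) \<in> weights A" using fin by (auto simp: weights_def)
  then have "\<exists>p. opt p"
    using continuous_attains_sup[OF compact_weights[OF fin] _ continuous_on_information[of A B V]] nonneg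
    unfolding opt_def by blast
  then obtain p where p: "opt p" and
    min: "\<And>q. opt q \<Longrightarrow> card {a. p a \<noteq> 0} \<le> card {a. q a \<noteq> 0}"
    using ex_has_least_nat[of opt _ "\<lambda>p. card {a. p a \<noteq> 0}"] by blast
  have p_nonneg: "0 \<le> p a" for a using p by (cases "a \<in> A") (auto simp: opt_def weights_def)
  have p_out: "p a = 0" if "a \<notin> A" for a using p that by (auto simp: opt_def weights_def)
  have p_sum: "sum p A = 1" using p by (auto simp: opt_def weights_def)
  define h where "h a = (\<Sum>y\<in>B. xlog (V a y))" for a
  \<comment> \<open>Here \<open>c\<close> is a dependency among the output laws on the support of
    \<open>p\<close>. Moving along it fixes the output distribution, so the information changes
    linearly, at the rate \<open>\<Sum>a\<in>A. c a * h a\<close>.\<close>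
  have no_ascent: False
    if supp: "\<And>a. p a = 0 \<Longrightarrow> c a = 0" and ker: "\<And>y. y \<in> B \<Longrightarrow> (\<Sum>a\<in>A. c a * V a y) = 0"
      and nz: "c b \<noteq> 0" and slope: "0 \<le> (\<Sum>a\<in>A. c a * h a)" for c b
  proof -
    \<comment> \<open>Each output law has mass 1, so a dependency has total weight 0; being nonzero,
      it has a negative entry.\<close>
    have "(\<Sum>a\<in>A. c a) = (\<Sum>a\<in>A. c a * (\<Sum>y\<in>B. V a y))" using total by simp
    also have "\<dots> = (\<Sum>y\<in>B. \<Sum>a\<in>A. c a * V a y)"
      by (simp add: sum_distrib_left) (rule sum.swap)
    finally have c_sum: "sum c A = 0" using ker by simp
    have "b \<in> A" using nz supp p_out by blast
    have "\<exists>a\<in>A. c a < 0"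
    proof (rule ccontr)
      assume "\<not> ?thesis"
      then have "\<forall>a\<in>A. c a = 0" using sum_nonneg_eq_0_iff[of A c] fin c_sum by fastforce
      then show False using nz \<open>b \<in> A\<close> by blast
    qed
    then have N: "finite {a\<in>A. c a < 0}" "{a\<in>A. c a < 0} \<noteq> {}" using fin by auto
    \<comment> \<open>The largest step that keeps every \<open>p a + t * c a\<close> nonnegative; at
      the minimising index \<open>d\<close> the weight drops to 0.\<close>
    define t where "t = Min ((\<lambda>a. p a / (- c a)) ` {a\<in>A. c a < 0})"
    obtain d where d: "d \<in> A" "c d < 0" "t = p d / (- c d)"
      using Min_in[of "(\<lambda>a. p a / (- c a)) ` {a\<in>A. c a < 0}"] N unfolding t_def by blast
    have t_nonneg: "0 \<le> t" using d p_nonneg[of d] by (simp add: divide_nonneg_neg)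
    define q where "q a = p a + t * c a" for a
    have "0 \<le> q a" if "a \<in> A" for a
    proof (cases "c a < 0")
      case True
      then have "t \<le> p a / (- c a)" using N that unfolding t_def by (intro Min_le) auto
      then show ?thesis using True by (simp add: q_def field_simps)
    qed (auto simp: q_def p_nonneg t_nonneg)
    moreover have "q a = 0" if "a \<notin> A" for a using that supp p_out by (simp add: q_def)
    moreover have "sum q A = 1" by (simp add: q_def sum.distrib sum_distrib_left[symmetric] c_sum p_sum)
    ultimately have q: "q \<in> weights A" by (simp add: weights_def)
    have "(\<Sum>a\<in>A. q a * V a y) = (\<Sum>a\<in>A. p a * V a y)" if "y \<in> B" for y
    proof -
      have "(\<Sum>a\<in>A. q a * V a y) = (\<Sum>a\<in>A. p a * V a y) + t * (\<Sum>a\<in>A. c a * V a y)"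
        by (simp add: q_def distrib_right sum.distrib sum_distrib_left mult.assoc)
      then show ?thesis using ker that by simp
    qed
    moreover have "(\<Sum>a\<in>A. q a * h a) = (\<Sum>a\<in>A. p a * h a) + t * (\<Sum>a\<in>A. c a * h a)"
      by (simp add: q_def distrib_right sum.distrib sum_distrib_left mult.assoc)
    ultimately have "information A B V p \<le> information A B V q"
      using slope t_nonneg by (simp add: information_def h_def[symmetric])
    then have "opt q" using p q unfolding opt_def by force
    moreover have "card {a. q a \<noteq> 0} < card {a. p a \<noteq> 0}"
    proof (rule psubset_card_mono)
      show "finite {a. p a \<noteq> 0}" by (rule finite_subset[OF _ fin]) (use p_out in blast)
      have "q d = 0" "p d \<noteq> 0" using d supp[of d] by (auto simp: q_def)
      moreover have "{a. q a \<noteq> 0} \<subseteq> {a. p a \<noteq> 0}" using supp by (auto simp: q_def)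
      ultimately show "{a. q a \<noteq> 0} \<subset> {a. p a \<noteq> 0}" by blast
    qed
    ultimately show False using min[of q] by simp
  qed
  \<comment> \<open>Both \<open>c\<close> and its negative are dependencies, and one of the two has
    nonnegative slope.\<close>
  have "c b = 0"
    if "\<forall>a. p a = 0 \<longrightarrow> c a = 0" "\<forall>y\<in>B. (\<Sum>a\<in>A. c a * V a y) = 0" for c b
  proof (rule ccontr)
    assume "c b \<noteq> 0"
    moreover have "(\<Sum>a\<in>A. - c a * h a) = - (\<Sum>a\<in>A. c a * h a)" by (simp add: sum_negf)
    moreover have "(\<Sum>a\<in>A. - c a * V a y) = - (\<Sum>a\<in>A. c a * V a y)" for y by (simp add: sum_negf)
    ultimately show False
      using no_ascent[of c b] no_ascent[of "\<lambda>a. - c a" b] that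
      by (cases "0 \<le> (\<Sum>a\<in>A. c a * h a)") auto
  qed
  then show thesis using that[of p] p unfolding opt_def by blast
qed

text \<open>If \<open>S\<close> had more elements than \<open>K\<close>, some nonzero
  \<open>c\<close> on \<open>S\<close>, extended by 0, would be annihilated by all functionals in
  \<open>K\<close>. These determine the output, so \<open>c\<close> would be a dependency, against
  independence.\<close>

lemma card_support_le:
  fixes \<phi> :: "'k \<Rightarrow> 'a \<Rightarrow> real"
  assumes fin: "finite A" "finite K"
    and sub: "S \<subseteq> A"
    and indep: "\<And>c. (\<And>a. a \<notin> S \<Longrightarrow> c a = 0) \<Longrightarrow>
      (\<And>y. y \<in> B \<Longrightarrow> (\<Sum>a\<in>A. c a * V a y) = 0) \<Longrightarrow> c = (\<lambda>_. 0)"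
    and determined: "\<And>c y. (\<And>k. k \<in> K \<Longrightarrow> (\<Sum>a\<in>A. c a * \<phi> k a) = 0) \<Longrightarrow> y \<in> B \<Longrightarrow>
      (\<Sum>a\<in>A. c a * V a y) = (0::real)"
  shows "card S \<le> card K"
proof (rule ccontr)
  assume "\<not> ?thesis"
  then obtain c where c: "\<exists>a\<in>S. c a \<noteq> 0" "\<And>k. k \<in> K \<Longrightarrow> (\<Sum>a\<in>S. c a * \<phi> k a) = 0"
    using underdetermined_system[of K S \<phi>] fin sub finite_subset by (metis not_le)
  define d where "d a = (if a \<in> S then c a else 0)" for a
  have "(\<Sum>a\<in>A. d a * \<phi> k a) = (\<Sum>a\<in>S. c a * \<phi> k a)" for k
    using fin sub by (intro sum.mono_neutral_cong_right) (auto simp: d_def)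
  then have "d = (\<lambda>_. 0)" using indep[of d] determined[of d] c(2) by (simp add: d_def)
  then show False using c(1) by (metis d_def)
qed

section \<open>Mutual information on finite spaces\<close>

text \<open>Every function on a finite point measure is simple, so the formula for simply
  distributed variables applies. The three densities are prescribed only at attained values.\<close>

lemma mutual_information_point_measure:
  fixes f :: "'s \<Rightarrow> real"
  assumes fin: "finite S" and nonneg: "\<And>s. s \<in> S \<Longrightarrow> 0 \<le> f s" and one: "sum f S = 1"
    and pX: "\<And>x. 0 \<le> PX x" "\<And>x. x \<in> g ` S \<Longrightarrow> PX x = (\<Sum>s | s \<in> S \<and> g s = x. f s)"
    and pY: "\<And>y. 0 \<le> PY y" "\<And>y. y \<in> h ` S \<Longrightarrow> PY y = (\<Sum>s | s \<in> S \<and> h s = y. f s)"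
    and pXY: "\<And>z. 0 \<le> PXY z"
      "\<And>s. s \<in> S \<Longrightarrow> PXY (g s, h s) = (\<Sum>s' | s' \<in> S \<and> g s' = g s \<and> h s' = h s. f s')"
  shows "prob_space.mutual_information (point_measure S (\<lambda>s. ennreal (f s))) 2
       (count_space (g ` S)) (count_space (h ` S)) g h =
     (\<Sum>(x, y)\<in>(\<lambda>s. (g s, h s)) ` S. PXY (x, y) * log 2 (PXY (x, y) / (PX x * PY y)))"
proof -
  let ?M = "point_measure S (\<lambda>s. ennreal (f s))"
  interpret prob_space ?M
    using fin nonneg one by (intro prob_space_point_measure) (auto simp: sum_ennreal)
  interpret information_space ?M 2 by unfold_locales simp
  have sf: "simple_function ?M k" for k :: "'s \<Rightarrow> 'c"
    using fin by (auto simp: simple_function_def space_point_measure sets_point_measure)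
  have m: "measure ?M T = (\<Sum>s\<in>T. f s)" if "T \<subseteq> S" for T
    using that fin nonneg sum_nonneg[of T f] finite_subset[of T S]
    by (simp add: measure_def emeasure_point_measure_finite subset_eq sum_ennreal)
  have "simple_distributed ?M g PX"
    by (rule simple_distributedI[OF sf pX(1)])
       (auto simp: space_point_measure m pX(2) intro!: sum.cong)
  moreover have "simple_distributed ?M h PY"
    by (rule simple_distributedI[OF sf pY(1)])
       (auto simp: space_point_measure m pY(2) intro!: sum.cong)
  moreover have "simple_distributed ?M (\<lambda>s. (g s, h s)) PXY"
    by (rule simple_distributedI[OF sf pXY(1)])
       (auto simp: space_point_measure m pXY(2) intro!: sum.cong)
  ultimately show ?thesis
    using mutual_information_simple_distributed[of g PX h PY PXY] by (simp add: space_point_measure)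
qed

text \<open>Termwise, \<open>p a\<close> cancels inside the logarithm and the quotient splits; where
  \<open>p a\<close> or \<open>V a y\<close> is 0, both sides are 0.\<close>

lemma mutual_information_eq:
  assumes fin: "finite A" and p: "\<And>a. a \<in> A \<Longrightarrow> 0 \<le> p a"
    and V: "\<And>a y. a \<in> A \<Longrightarrow> y \<in> B \<Longrightarrow> 0 \<le> V a y"
  shows "(\<Sum>a\<in>A. \<Sum>y\<in>B. p a * V a y * log 2 (p a * V a y / (p a * (\<Sum>b\<in>A. p b * V b y)))) =
    information A B V p"
proof -
  let ?q = "\<lambda>y. \<Sum>b\<in>A. p b * V b y"
  have "p a * V a y * log 2 (p a * V a y / (p a * ?q y)) = p a * xlog (V a y) - p a * V a y * log 2 (?q y)"
    if "a \<in> A" "y \<in> B" for a y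
  proof (cases "p a = 0 \<or> V a y = 0")
    case False
    then have "0 < p a" "0 < V a y" using p V that by (auto simp: less_le)
    \<comment> \<open>Splitting the logarithm needs a positive output probability; it is bounded
      below by this one positive summand.\<close>
    moreover have "p a * V a y \<le> ?q y" using member_le_sum[of a A "\<lambda>b. p b * V b y"] fin p V that by simp
    ultimately have "0 < ?q y" using mult_pos_pos[of "p a" "V a y"] by linarith
    then show ?thesis using \<open>0 < p a\<close> \<open>0 < V a y\<close> by (simp add: xlog_def log_divide algebra_simps)
  qed (auto simp: xlog_def)
  then have "(\<Sum>a\<in>A. \<Sum>y\<in>B. p a * V a y * log 2 (p a * V a y / (p a * ?q y))) =
    (\<Sum>a\<in>A. \<Sum>y\<in>B. p a * xlog (V a y)) - (\<Sum>a\<in>A. \<Sum>y\<in>B. p a * V a y * log 2 (?q y))"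
    by (simp add: sum_subtractf)
  also have "(\<Sum>a\<in>A. \<Sum>y\<in>B. p a * V a y * log 2 (?q y)) = (\<Sum>y\<in>B. xlog (?q y))"
    unfolding xlog_def sum_distrib_right by (rule sum.swap)
  finally show ?thesis by (simp add: information_def sum_distrib_left)
qed

section \<open>Words, prefixes and causal consistency\<close>

lemma finite_words: "(\<And>i. i \<in> {1..n} \<Longrightarrow> finite (A i)) \<Longrightarrow> finite (words A n)"
  unfolding words_def by (intro finite_PiE) auto

lemma words_nonempty: "(\<And>i. i \<in> {1..n} \<Longrightarrow> A i \<noteq> {}) \<Longrightarrow> words A n \<noteq> {}"
  by (simp add: words_def PiE_eq_empty_iff)

lemma atLeastAtMost_1_Suc: "{1..Suc n} = insert (Suc n) {1..n}"
  by auto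

lemma words_Suc: "words A (Suc n) = (\<lambda>(v, w). w(Suc n := v)) ` (A (Suc n) \<times> words A n)"
  unfolding words_def atLeastAtMost_1_Suc by (rule PiE_insert_eq)

lemma sum_words_Suc:
  "(\<Sum>w\<in>words A (Suc n). f w) = (\<Sum>w\<in>words A n. \<Sum>v\<in>A (Suc n). f (w(Suc n := v)))"
proof -
  have "inj_on (\<lambda>(v, w). w(Suc n := v)) (A (Suc n) \<times> words A n)"
    unfolding words_def by (rule inj_combinator) simp
  then have "(\<Sum>w\<in>words A (Suc n). f w) = (\<Sum>(v, w)\<in>A (Suc n) \<times> words A n. f (w(Suc n := v)))"
    unfolding words_Suc by (subst sum.reindex) (simp_all add: case_prod_unfold)
  then show ?thesis by (simp add: sum.cartesian_product[symmetric] sum.swap[of _ "A (Suc n)"])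
qed

lemma words_SucE:
  assumes "w \<in> words A (Suc n)"
  obtains v w' where "v \<in> A (Suc n)" "w' \<in> words A n" "w = w'(Suc n := v)"
  using assms unfolding words_Suc by auto

lemma upd_in_words: "w \<in> words A n \<Longrightarrow> v \<in> A (Suc n) \<Longrightarrow> w(Suc n := v) \<in> words A (Suc n)"
  unfolding words_Suc by force

lemma prefix_words: "w \<in> words A n \<Longrightarrow> prefix n w = w"
  by (simp add: words_def prefix_def PiE_restrict)

lemma prefix_in_words: "w \<in> words A n \<Longrightarrow> m \<le> n \<Longrightarrow> prefix m w \<in> words A m"
  by (auto simp: words_def prefix_def)

lemma prefix_prefix: "m \<le> n \<Longrightarrow> prefix m (prefix n w) = prefix m w"
  by (auto simp: prefix_def restrict_def fun_eq_iff)

lemma prefix_upd: "m \<le> n \<Longrightarrow> prefix m (w(Suc n := v)) = prefix m w"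
  by (auto simp: prefix_def restrict_def fun_eq_iff)

lemma prefix_Suc_upd: "w \<in> words A n \<Longrightarrow> prefix (Suc n) (w(Suc n := v)) = w(Suc n := v)"
  by (auto simp: prefix_def restrict_def fun_eq_iff words_def PiE_iff extensional_def)

lemma consistent_0: "consistent 0 x a z"
  by (simp add: consistent_def)

text \<open>The input at position \<open>i\<close> sees feedback only up to \<open>i - 1\<close>. So
  \<open>n\<close> inputs are settled by \<open>n - 1\<close> feedback symbols, whence the bound
  \<open>Suc m\<close>.\<close>

lemma consistent_prefix: "n \<le> Suc m \<Longrightarrow> consistent n x a (prefix m z) = consistent n x a z"
  by (auto simp: consistent_def prefix_prefix)

lemma consistent_Suc:
  assumes "z \<in> words Z n"
  shows "consistent (Suc n) (x(Suc n := v)) a z \<longleftrightarrow> consistent n x a z \<and> v = a (Suc n) z"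
  unfolding consistent_def atLeastAtMost_1_Suc using prefix_words[OF assms] by auto

lemma consistent_upd: "n \<le> Suc m \<Longrightarrow> consistent n x a (z(Suc m := u)) = consistent n x a z"
  by (auto simp: consistent_def prefix_upd)

lemma block_law_Suc:
  assumes "x \<in> words X n" "y \<in> words Y n" "z \<in> words Z n"
  shows "block_law (Suc n) W (x(Suc n := s)) (y(Suc n := t)) (z(Suc n := u)) =
    block_law n W x y z * pmf (W (Suc n) y z (x(Suc n := s))) (t, u)"
proof -
  have "(\<Prod>i=1..n. pmf (W i (prefix (i - 1) (y(Suc n := t))) (prefix (i - 1) (z(Suc n := u)))
      (prefix i (x(Suc n := s)))) ((y(Suc n := t)) i, (z(Suc n := u)) i)) = block_law n W x y z"
    unfolding block_law_def by (intro prod.cong) (auto simp: prefix_upd)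
  then show ?thesis
    using assms by (simp add: block_law_def prefix_upd prefix_words prefix_Suc_upd)
qed

lemma block_law_nonneg: "0 \<le> block_law n W x y z"
  by (simp add: block_law_def prod_nonneg)

section \<open>The channel from code functions to output words\<close>

locale block_channel =
  fixes L :: nat and X :: "nat \<Rightarrow> 'x set" and Y :: "nat \<Rightarrow> 'y set" and Z :: "nat \<Rightarrow> 'z set"
    and W :: "('x, 'y, 'z) kernel"
  assumes X: "\<And>i. i \<in> {1..L} \<Longrightarrow> finite (X i) \<and> X i \<noteq> {}"
    and Y: "\<And>i. i \<in> {1..L} \<Longrightarrow> finite (Y i) \<and> Y i \<noteq> {}"
    and Z: "\<And>i. i \<in> {1..L} \<Longrightarrow> finite (Z i) \<and> Z i \<noteq> {}"
    and kernel: "channel_kernel L X Y Z W"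
begin

abbreviation codes :: "(nat \<Rightarrow> (nat \<Rightarrow> 'z) \<Rightarrow> 'x) set" where
  "codes \<equiv> code_functions L X Z"

text \<open>The conditional law of the output word given the code function, with inputs and feedback
  summed out. The code function thereby becomes the input letter of an ordinary channel.\<close>

definition output_law :: "(nat \<Rightarrow> (nat \<Rightarrow> 'z) \<Rightarrow> 'x) \<Rightarrow> (nat \<Rightarrow> 'y) \<Rightarrow> real" where
  "output_law a y =
     (\<Sum>x\<in>words X L. \<Sum>z\<in>words Z L. of_bool (consistent L x a z) * block_law L W x y z)"

lemma finite_wordsX: "n \<le> L \<Longrightarrow> finite (words X n)" by (rule finite_words) (use X in auto)
lemma finite_wordsY: "n \<le> L \<Longrightarrow> finite (words Y n)" by (rule finite_words) (use Y in auto)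
lemma finite_wordsZ: "n \<le> L \<Longrightarrow> finite (words Z n)" by (rule finite_words) (use Z in auto)

lemma finite_codes: "finite codes"
  unfolding code_functions_def using X finite_wordsZ by (intro finite_PiE) auto

lemma codes_nonempty: "codes \<noteq> {}"
  using X by (auto simp: code_functions_def PiE_eq_empty_iff)

lemma code_value: "a \<in> codes \<Longrightarrow> z \<in> words Z n \<Longrightarrow> n < L \<Longrightarrow> a (Suc n) z \<in> X (Suc n)"
  by (fastforce simp: code_functions_def PiE_iff)

lemma output_law_nonneg: "0 \<le> output_law a y"
  by (simp add: output_law_def sum_nonneg block_law_nonneg)

text \<open>Given the past feedback, exactly one next input agrees with the code function, and it
  lies in the alphabet.\<close>

lemma sum_consistent:
  assumes "a \<in> codes" "z \<in> words Z n" "n < L"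
  shows "(\<Sum>v\<in>X (Suc n). of_bool (consistent (Suc n) (x(Suc n := v)) a z) * (g v :: real)) =
    of_bool (consistent n x a z) * g (a (Suc n) z)"
proof -
  have "finite (X (Suc n))" using X assms by auto
  then show ?thesis using code_value[OF assms]
    by (simp add: consistent_Suc[OF assms(2)] of_bool_conj mult.assoc sum_distrib_left[symmetric]
        of_bool_def if_distrib if_distribR cong: if_cong)
qed

text \<open>Induction on the length: the sum over the last input selects the one prescribed by
  \<open>a\<close>, and the kernel then has mass 1 on the last output and feedback pair.\<close>

lemma block_law_total:
  assumes a: "a \<in> codes" and "n \<le> L"
  shows "(\<Sum>y\<in>words Y n. \<Sum>x\<in>words X n. \<Sum>z\<in>words Z n.
    of_bool (consistent n x a z) * block_law n W x y z) = 1"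
  using \<open>n \<le> L\<close>
proof (induction n)
  case 0
  then show ?case by (simp add: words_def consistent_0 block_law_def)
next
  case (Suc n)
  have step: "(\<Sum>t\<in>Y (Suc n). \<Sum>s\<in>X (Suc n). \<Sum>u\<in>Z (Suc n).
      of_bool (consistent (Suc n) (x(Suc n := s)) a (z(Suc n := u))) *
      block_law (Suc n) W (x(Suc n := s)) (y(Suc n := t)) (z(Suc n := u))) =
    of_bool (consistent n x a z) * block_law n W x y z"
    if x: "x \<in> words X n" and y: "y \<in> words Y n" and z: "z \<in> words Z n" for x y z
  proof -
    let ?p = "\<lambda>s. W (Suc n) y z (x(Suc n := s))"
    have "(\<Sum>s\<in>X (Suc n). \<Sum>u\<in>Z (Suc n).
        of_bool (consistent (Suc n) (x(Suc n := s)) a (z(Suc n := u))) *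
        block_law (Suc n) W (x(Suc n := s)) (y(Suc n := t)) (z(Suc n := u))) =
      of_bool (consistent n x a z) * (block_law n W x y z * (\<Sum>u\<in>Z (Suc n). pmf (?p (a (Suc n) z)) (t, u)))" for t
      using sum_consistent[OF a z, of x "\<lambda>s. block_law n W x y z * (\<Sum>u\<in>Z (Suc n). pmf (?p s) (t, u))"] Suc.prems
      by (simp add: consistent_upd block_law_Suc[OF x y z] sum_distrib_left)
    then have "(\<Sum>t\<in>Y (Suc n). \<Sum>s\<in>X (Suc n). \<Sum>u\<in>Z (Suc n).
        of_bool (consistent (Suc n) (x(Suc n := s)) a (z(Suc n := u))) *
        block_law (Suc n) W (x(Suc n := s)) (y(Suc n := t)) (z(Suc n := u))) =
      of_bool (consistent n x a z) * block_law n W x y z *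
        (\<Sum>t\<in>Y (Suc n). \<Sum>u\<in>Z (Suc n). pmf (?p (a (Suc n) z)) (t, u))"
      by (simp add: sum_distrib_left mult.assoc)
    also have "(\<Sum>t\<in>Y (Suc n). \<Sum>u\<in>Z (Suc n). pmf (?p (a (Suc n) z)) (t, u)) =
        (\<Sum>w\<in>Y (Suc n) \<times> Z (Suc n). pmf (?p (a (Suc n) z)) w)"
      by (simp add: sum.cartesian_product case_prod_unfold)
    also have "\<dots> = 1"
    proof (rule sum_pmf_eq_1)
      show "finite (Y (Suc n) \<times> Z (Suc n))" using Y Z Suc.prems by auto
      \<comment> \<open>\<open>channel_kernel\<close> restricts the support only for admissible
        input words, so the extended word has to be one.\<close>
      have "x(Suc n := a (Suc n) z) \<in> words X (Suc n)"
        using upd_in_words[OF x] code_value[OF a z] Suc.prems by simp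
      moreover have "Suc n \<in> {1..L}" using Suc.prems by simp
      ultimately show "set_pmf (?p (a (Suc n) z)) \<subseteq> Y (Suc n) \<times> Z (Suc n)"
        using kernel y z unfolding channel_kernel_def by (metis diff_Suc_1)
    qed
    finally show ?thesis by (simp only: mult_1_right)
  qed
  have "(\<Sum>y\<in>words Y (Suc n). \<Sum>x\<in>words X (Suc n). \<Sum>z\<in>words Z (Suc n).
      of_bool (consistent (Suc n) x a z) * block_law (Suc n) W x y z) =
    (\<Sum>y\<in>words Y n. \<Sum>t\<in>Y (Suc n). \<Sum>x\<in>words X n. \<Sum>s\<in>X (Suc n). \<Sum>z\<in>words Z n. \<Sum>u\<in>Z (Suc n).
      of_bool (consistent (Suc n) (x(Suc n := s)) a (z(Suc n := u))) *
      block_law (Suc n) W (x(Suc n := s)) (y(Suc n := t)) (z(Suc n := u)))"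
    by (simp only: sum_words_Suc)
  \<comment> \<open>The sums over the new letters move innermost, where \<open>step\<close>
    evaluates them.\<close>
  also have "\<dots> = (\<Sum>y\<in>words Y n. \<Sum>x\<in>words X n. \<Sum>z\<in>words Z n.
      \<Sum>t\<in>Y (Suc n). \<Sum>s\<in>X (Suc n). \<Sum>u\<in>Z (Suc n).
      of_bool (consistent (Suc n) (x(Suc n := s)) a (z(Suc n := u))) *
      block_law (Suc n) W (x(Suc n := s)) (y(Suc n := t)) (z(Suc n := u)))"
    by (simp only: sum.swap[of _ "Y (Suc n)" "words X n"] sum.swap[of _ "X (Suc n)" "words Z n"]
        sum.swap[of _ "Y (Suc n)" "words Z n"])
  also have "\<dots> = 1" using Suc by (simp add: step)
  finally show ?case .
qed

lemma output_law_total: "a \<in> codes \<Longrightarrow> (\<Sum>y\<in>words Y L. output_law a y) = 1"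
  unfolding output_law_def by (rule block_law_total) auto

lemma pmf_in_weights: "P \<in> code_dists L X Z \<Longrightarrow> pmf P \<in> weights codes"
  using sum_pmf_eq_1[OF finite_codes, of P]
  by (auto simp: code_dists_def weights_def set_pmf_iff)

text \<open>Converse of \<open>pmf_in_weights\<close>: a maximiser found among weight vectors is a
  genuine code distribution.\<close>

lemma weights_pmf:
  assumes "p \<in> weights codes"
  obtains P where "P \<in> code_dists L X Z" "pmf P = p"
proof
  have nonneg: "0 \<le> p a" for a using assms by (cases "a \<in> codes") (auto simp: weights_def)
  have "(\<integral>\<^sup>+a. ennreal (p a) \<partial>count_space UNIV) = (\<Sum>a\<in>codes. ennreal (p a))"
    using assms finite_codes by (intro nn_integral_count_space'[of codes]) (auto simp: weights_def)
  also have "\<dots> = 1" using assms by (simp add: weights_def sum_ennreal)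
  finally have one: "(\<integral>\<^sup>+a. ennreal (p a) \<partial>count_space UNIV) = 1" .
  show eq: "pmf (embed_pmf p) = p" by (rule ext) (rule pmf_embed_pmf[OF nonneg one])
  show "embed_pmf p \<in> code_dists L X Z"
    using assms by (auto simp: code_dists_def set_pmf_iff eq weights_def)
qed

text \<open>The joint law has marginals \<open>pmf P a\<close> for the code and
  \<open>pmf P a * output_law a y\<close> for the pair, which turns the measure-theoretic quantity
  into the finite sum optimised above.\<close>

lemma code_information_eq:
  assumes "P \<in> code_dists L X Z"
  shows "code_information L X Y Z W P = information codes (words Y L) output_law (pmf P)"
proof -
  let ?R = "words X L \<times> words Y L \<times> words Z L"
  let ?S = "codes \<times> ?R"
  let ?f = "\<lambda>(a, x, y, z). pmf P a * of_bool (consistent L x a z) * block_law L W x y z"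
  let ?g = "\<lambda>(a, x, y, z). a" and ?h = "\<lambda>(a, x, y, z). y"
  \<comment> \<open>Nonempty alphabets make the projections surjective, so the count spaces are the
    images that the general formula asks for.\<close>
  have ne: "words X L \<noteq> {}" "words Y L \<noteq> {}" "words Z L \<noteq> {}"
    by (rule words_nonempty, use X Y Z in blast)+
  have g: "?g ` ?S = codes" using ne by (force simp: image_iff)
  have h: "?h ` ?S = words Y L" using ne codes_nonempty by (force simp: image_iff)
  have gh: "(\<lambda>s. (?g s, ?h s)) ` ?S = codes \<times> words Y L" using ne by (force simp: image_iff)
  \<comment> \<open>One computation for the total mass and all three marginals: \<open>A\<close> and
    \<open>B\<close> are each the full set or a singleton.\<close>
  have sum_f: "(\<Sum>s\<in>A \<times> words X L \<times> B \<times> words Z L. ?f s) = (\<Sum>a\<in>A. \<Sum>y\<in>B. pmf P a * output_law a y)" for A B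
  proof -
    have "(\<Sum>s\<in>A \<times> words X L \<times> B \<times> words Z L. ?f s) =
      (\<Sum>a\<in>A. \<Sum>x\<in>words X L. \<Sum>y\<in>B. \<Sum>z\<in>words Z L. ?f (a, x, y, z))"
      by (simp add: sum.cartesian_product[symmetric])
    also have "\<dots> = (\<Sum>a\<in>A. \<Sum>y\<in>B. \<Sum>x\<in>words X L. \<Sum>z\<in>words Z L. ?f (a, x, y, z))"
      by (simp only: sum.swap[of _ "words X L" B])
    finally show ?thesis by (simp add: output_law_def sum_distrib_left mult.assoc)
  qed
  note w = pmf_in_weights[OF assms]
  have joint: "joint_law L X Y Z W P = point_measure ?S (\<lambda>s. ennreal (?f s))"
    unfolding joint_law_def by (rule arg_cong2[of _ _ _ _ point_measure]) (auto simp: fun_eq_iff)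
  have "code_information L X Y Z W P = (\<Sum>(a, y)\<in>(\<lambda>s. (?g s, ?h s)) ` ?S.
      (\<lambda>(a, y). pmf P a * output_law a y) (a, y) *
      log 2 ((\<lambda>(a, y). pmf P a * output_law a y) (a, y) /
        (pmf P a * (\<Sum>b\<in>codes. pmf P b * output_law b y))))"
    unfolding code_information_def joint
  proof (subst (1) g[symmetric], subst (1) h[symmetric], rule mutual_information_point_measure)
    show "finite ?S" using finite_codes finite_wordsX finite_wordsY finite_wordsZ by simp
    show "0 \<le> ?f s" for s by (auto simp: block_law_nonneg split: prod.splits)
    show "sum ?f ?S = 1"
      using w by (simp add: sum_f sum_distrib_left[symmetric] output_law_total weights_def)
    show "0 \<le> (\<lambda>(a, y). pmf P a * output_law a y) z" for z
      by (auto simp: output_law_nonneg split: prod.splits)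
    show "0 \<le> (\<Sum>b\<in>codes. pmf P b * output_law b y)" for y
      by (simp add: sum_nonneg output_law_nonneg)
  next
    fix a assume "a \<in> ?g ` ?S"
    then have a: "a \<in> codes" unfolding g .
    then have "{s. s \<in> ?S \<and> ?g s = a} = {a} \<times> words X L \<times> words Y L \<times> words Z L" by auto
    then show "pmf P a = (\<Sum>s | s \<in> ?S \<and> ?g s = a. ?f s)"
      using a by (simp add: sum_f sum_distrib_left[symmetric] output_law_total)
  next
    fix y assume "y \<in> ?h ` ?S"
    then have y: "y \<in> words Y L" unfolding h .
    then have "{s. s \<in> ?S \<and> ?h s = y} = codes \<times> words X L \<times> {y} \<times> words Z L" by auto
    then show "(\<Sum>b\<in>codes. pmf P b * output_law b y) = (\<Sum>s | s \<in> ?S \<and> ?h s = y. ?f s)"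
      by (simp add: sum_f)
  next
    fix s assume s: "s \<in> ?S"
    obtain a x y z where [simp]: "s = (a, x, y, z)" by (cases s)
    have "{s'. s' \<in> ?S \<and> ?g s' = ?g s \<and> ?h s' = ?h s} = {a} \<times> words X L \<times> {y} \<times> words Z L"
      using s by auto
    then show "(\<lambda>(a, y). pmf P a * output_law a y) (?g s, ?h s) =
        (\<Sum>s' | s' \<in> ?S \<and> ?g s' = ?g s \<and> ?h s' = ?h s. ?f s')"
      by (simp add: sum_f)
  qed simp
  also have "\<dots> = information codes (words Y L) output_law (pmf P)"
    using mutual_information_eq[OF finite_codes, of "pmf P" "words Y L" output_law] output_law_nonneg
    by (simp add: gh sum.cartesian_product[symmetric])
  finally show ?thesis .
qed

end

section \<open>Counting the causal indicators\<close>

lemma card_words_avoiding: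
  assumes "x0 \<in> A (Suc n)" "finite (A (Suc n))"
  shows "card {w \<in> words A (Suc n). w (Suc n) \<noteq> x0} = card (words A n) * (card (A (Suc n)) - 1)"
proof -
  have "{w \<in> words A (Suc n). w (Suc n) \<noteq> x0} =
    (\<lambda>(v, w). w(Suc n := v)) ` ((A (Suc n) - {x0}) \<times> words A n)"
    unfolding words_Suc by force
  moreover have "inj_on (\<lambda>(v, w). w(Suc n := v)) ((A (Suc n) - {x0}) \<times> words A n)"
    by (rule inj_on_subset[of _ "A (Suc n) \<times> words A n"])
       (auto simp: words_def intro: inj_combinator)
  ultimately show ?thesis
    using assms by (simp add: card_image card_cartesian_product mult.commute)
qed

context block_channel
begin

text \<open>
  Summing the causal indicator over the last input removes that input, so its values at the
  reference symbol \<open>x0 i\<close> follow from the others. The index at length 0 fixes the total mass.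
\<close>

definition indicator_indices :: "(nat \<Rightarrow> 'x) \<Rightarrow> (nat \<times> (nat \<Rightarrow> 'x) \<times> (nat \<Rightarrow> 'z)) set" where
  "indicator_indices x0 = insert (0, undefined, undefined)
     (SIGMA i:{1..L}. {x \<in> words X i. x i \<noteq> x0 i} \<times> words Z (i - 1))"

lemma finite_indicator_indices: "finite (indicator_indices x0)"
  using finite_wordsX finite_wordsZ by (auto simp: indicator_indices_def intro!: finite_SigmaI)

text \<open>Position 1 has only empty pasts and contributes \<open>card (X 1) - 1\<close>; the extra
  index of length 0 makes up the missing 1.\<close>

lemma card_indicator_indices:
  assumes "1 \<le> L" and x0: "\<And>i. i \<in> {1..L} \<Longrightarrow> x0 i \<in> X i"
  shows "card (indicator_indices x0) \<le> card (X 1) +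
    (\<Sum>i=2..L. card (words X (i - 1)) * card (words Z (i - 1)) * (card (X i) - 1))"
proof -
  let ?t = "\<lambda>i. card (words X (i - 1)) * card (words Z (i - 1)) * (card (X i) - 1)"
  let ?D = "\<lambda>i. {x \<in> words X i. x i \<noteq> x0 i} \<times> words Z (i - 1)"
  have "card (?D i) = ?t i" if i: "i \<in> {1..L}" for i
  proof -
    obtain n where "i = Suc n" using i by (cases i) auto
    then show ?thesis
      using card_words_avoiding[of "x0 i" X n] X[OF i] x0[OF i] by (simp add: card_cartesian_product)
  qed
  moreover have "card (Sigma {1..L} ?D) = (\<Sum>i=1..L. card (?D i))"
    using finite_wordsX finite_wordsZ by (intro card_SigmaI) auto
  ultimately have "card (Sigma {1..L} ?D) = (\<Sum>i=1..L. ?t i)"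
    by simp
  also have "\<dots> = ?t 1 + (\<Sum>i=2..L. ?t i)"
    using \<open>1 \<le> L\<close> by (simp add: sum.atLeast_Suc_atMost numeral_2_eq_2)
  also have "?t 1 = card (X 1) - 1"
    by (simp add: words_def)
  finally have "card (Sigma {1..L} ?D) = card (X 1) - 1 + (\<Sum>i=2..L. ?t i)" .
  moreover have "card (indicator_indices x0) \<le> Suc (card (Sigma {1..L} ?D))"
    unfolding indicator_indices_def by (rule card_insert_le_m1) simp_all
  \<comment> \<open>Subtraction on naturals is truncated, so adding the 1 back needs a nonempty
    first alphabet.\<close>
  moreover have "1 \<le> card (X 1)"
    using X[of 1] \<open>1 \<le> L\<close> by (simp add: Suc_le_eq card_gt_0_iff)
  ultimately show ?thesis by simp
qed

text \<open>Induction on the length. Summing over the last input gives the shorter indicator, whose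
  combination vanishes by induction; all summands away from \<open>x0\<close> vanish by hypothesis,
  hence so does the one at \<open>x0\<close>.\<close>

lemma indicators_determined:
  fixes c :: "(nat \<Rightarrow> (nat \<Rightarrow> 'z) \<Rightarrow> 'x) \<Rightarrow> real"
  assumes x0: "\<And>i. i \<in> {1..L} \<Longrightarrow> x0 i \<in> X i"
    and zero: "\<And>i x z. (i, x, z) \<in> indicator_indices x0 \<Longrightarrow>
      (\<Sum>a\<in>codes. c a * of_bool (consistent i x a z)) = 0"
    and "n \<le> L" "x \<in> words X n" "z \<in> words Z n"
  shows "(\<Sum>a\<in>codes. c a * of_bool (consistent n x a z)) = 0"
  using assms(3-)
proof (induction n arbitrary: x z)
  case 0
  then show ?case
    using zero[of 0 undefined undefined] by (simp add: indicator_indices_def consistent_0)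
next
  case (Suc n)
  \<comment> \<open>The indices pair \<open>Suc n\<close> inputs with \<open>n\<close> feedback
    symbols, so the last symbol of \<open>z\<close> is cut off; by \<open>consistent_prefix\<close>
    this changes nothing.\<close>
  let ?F = "\<lambda>v w. \<Sum>a\<in>codes. c a * of_bool (consistent (Suc n) (w(Suc n := v)) a (prefix n z))"
  have z: "prefix n z \<in> words Z n" using Suc.prems by (simp add: prefix_in_words)
  have i: "Suc n \<in> {1..L}" using Suc.prems by simp
  obtain v w where v: "v \<in> X (Suc n)" and w: "w \<in> words X n" and x: "x = w(Suc n := v)"
    using Suc.prems by (auto elim: words_SucE)
  have off: "?F s w = 0" if "s \<in> X (Suc n)" "s \<noteq> x0 (Suc n)" for s
    using zero[of "Suc n" "w(Suc n := s)" "prefix n z"] that upd_in_words[OF w] z i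
    by (simp add: indicator_indices_def)
  have "(\<Sum>s\<in>X (Suc n). ?F s w) =
    (\<Sum>a\<in>codes. c a * (\<Sum>s\<in>X (Suc n). of_bool (consistent (Suc n) (w(Suc n := s)) a (prefix n z)) * 1))"
    by (simp add: sum_distrib_left sum.swap[of _ "X (Suc n)"])
  also have "\<dots> = (\<Sum>a\<in>codes. c a * of_bool (consistent n w a (prefix n z)))"
    using Suc.prems by (intro sum.cong refl) (subst sum_consistent[OF _ z], auto)
  also have "\<dots> = 0" using Suc.IH[OF _ w z] Suc.prems by simp
  finally have "(\<Sum>s\<in>X (Suc n). ?F s w) = 0" .
  moreover have "(\<Sum>s\<in>X (Suc n). ?F s w) = ?F (x0 (Suc n)) w"
    using X[OF i] x0[OF i] off by (subst sum.remove[of _ "x0 (Suc n)"]) auto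
  ultimately have "?F v w = 0" using off v by (cases "v = x0 (Suc n)") simp_all
  then show ?case unfolding x by (simp only: consistent_prefix le_SucI order_refl)
qed

text \<open>The output law is linear in the causal indicators, with coefficients from
  \<open>block_law\<close> that do not involve the code function.\<close>

lemma output_determined:
  fixes c :: "(nat \<Rightarrow> (nat \<Rightarrow> 'z) \<Rightarrow> 'x) \<Rightarrow> real"
  assumes "\<And>x z. x \<in> words X L \<Longrightarrow> z \<in> words Z L \<Longrightarrow>
    (\<Sum>a\<in>codes. c a * of_bool (consistent L x a z)) = 0"
  shows "(\<Sum>a\<in>codes. c a * output_law a y) = 0"
proof -
  have "(\<Sum>a\<in>codes. c a * output_law a y) =
    (\<Sum>a\<in>codes. \<Sum>x\<in>words X L. \<Sum>z\<in>words Z L. c a * of_bool (consistent L x a z) * block_law L W x y z)"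
    unfolding output_law_def by (simp only: sum_distrib_left mult.assoc)
  also have "\<dots> =
    (\<Sum>x\<in>words X L. \<Sum>z\<in>words Z L. \<Sum>a\<in>codes. c a * of_bool (consistent L x a z) * block_law L W x y z)"
    by (simp only: sum.swap[of _ codes "words X L"] sum.swap[of _ codes "words Z L"])
  also have "\<dots> = (\<Sum>x\<in>words X L. \<Sum>z\<in>words Z L.
      (\<Sum>a\<in>codes. c a * of_bool (consistent L x a z)) * block_law L W x y z)"
    by (simp only: sum_distrib_right)
  also have "\<dots> = 0" by (intro sum.neutral ballI) (simp only: assms mult_zero_left)
  finally show ?thesis .
qed

end

section \<open>Attainment of the capacity with small support\<close>

theorem theorem3:
  fixes L :: nat
    and X :: "nat \<Rightarrow> 'x set" and Y :: "nat \<Rightarrow> 'y set" and Z :: "nat \<Rightarrow> 'z set"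
    and W :: "('x, 'y, 'z) kernel"
  assumes "L \<ge> 1"
    and "\<And>i. i \<in> {1..L} \<Longrightarrow> finite (X i) \<and> X i \<noteq> {}"
    and "\<And>i. i \<in> {1..L} \<Longrightarrow> finite (Y i) \<and> Y i \<noteq> {}"
    and "\<And>i. i \<in> {1..L} \<Longrightarrow> finite (Z i) \<and> Z i \<noteq> {}"
    and "channel_kernel L X Y Z W"
  shows "\<exists>P\<in>code_dists L X Z.
      code_information L X Y Z W P / real L = capacity_expression L X Y Z W \<and>
      (\<forall>Q\<in>code_dists L X Z.
         code_information L X Y Z W Q / real L \<le> code_information L X Y Z W P / real L) \<and>
      card (set_pmf P) \<le>
        min (card (words Y L))
            (card (X 1) +
             (\<Sum>i=2..L. card (words X (i - 1)) * card (words Z (i - 1)) * (card (X i) - 1)))"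
proof -
  interpret block_channel L X Y Z W using assms(2-) by unfold_locales
  obtain p where p: "p \<in> weights codes"
    and max: "\<forall>q\<in>weights codes.
      information codes (words Y L) output_law q \<le> information codes (words Y L) output_law p"
    and indep: "\<forall>c. (\<forall>a. p a = 0 \<longrightarrow> c a = 0) \<longrightarrow>
      (\<forall>y\<in>words Y L. (\<Sum>a\<in>codes. c a * output_law a y) = 0) \<longrightarrow> c = (\<lambda>_. 0)"
    using optimal_weights[OF finite_codes codes_nonempty output_law_nonneg output_law_total] .
  obtain P where P: "P \<in> code_dists L X Z" and pmf_P: "pmf P = p"
    using weights_pmf[OF p] .
  have best: "code_information L X Y Z W Q / real L \<le> code_information L X Y Z W P / real L"
    if "Q \<in> code_dists L X Z" for Q
    using bspec[OF max pmf_in_weights[OF that]] \<open>1 \<le> L\<close>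
    by (simp add: code_information_eq that P pmf_P divide_right_mono)
  have supp: "set_pmf P \<subseteq> codes" using P by (simp add: code_dists_def)
  have indep': "c = (\<lambda>_. 0)" if "\<And>a. a \<notin> set_pmf P \<Longrightarrow> c a = 0"
    "\<And>y. y \<in> words Y L \<Longrightarrow> (\<Sum>a\<in>codes. c a * output_law a y) = 0" for c
    using that by (intro indep[rule_format]) (simp_all add: set_pmf_iff pmf_P)
  \<comment> \<open>Any reference symbols will do; the count is the same for each choice.\<close>
  define x0 where "x0 i = (SOME v. v \<in> X i)" for i
  have x0: "x0 i \<in> X i" if "i \<in> {1..L}" for i
    using X[OF that] by (simp add: x0_def some_in_eq)
  \<comment> \<open>First family of functionals: the output probabilities, which trivially determine
    the output.\<close>
  have "card (set_pmf P) \<le> card (words Y L)"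
    by (rule card_support_le[where B = "words Y L" and V = output_law
          and \<phi> = "\<lambda>y a. output_law a y", OF finite_codes finite_wordsY supp indep']) auto
  \<comment> \<open>Second family, for the same \<open>P\<close>: the reduced causal indicators
    determine all indicators of length \<open>L\<close>, and these determine the output.\<close>
  moreover have "card (set_pmf P) \<le> card (indicator_indices x0)"
  proof (rule card_support_le[OF finite_codes finite_indicator_indices supp indep'])
    fix c :: "(nat \<Rightarrow> (nat \<Rightarrow> 'z) \<Rightarrow> 'x) \<Rightarrow> real" and y
    assume vanish: "\<And>k. k \<in> indicator_indices x0 \<Longrightarrow>
      (\<Sum>a\<in>codes. c a * (case k of (i, x, z) \<Rightarrow> of_bool (consistent i x a z))) = 0"
    have zero: "(\<Sum>a\<in>codes. c a * of_bool (consistent i x a z)) = 0"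
      if "(i, x, z) \<in> indicator_indices x0" for i x z
      using vanish[OF that] by (simp only: prod.case)
    show "(\<Sum>a\<in>codes. c a * output_law a y) = 0"
      by (rule output_determined, rule indicators_determined[OF x0 zero order_refl])
  qed
  moreover have "code_information L X Y Z W P / real L = capacity_expression L X Y Z W"
    unfolding capacity_expression_def using P best by (intro cSup_eq_maximum[symmetric]) auto
  ultimately show ?thesis
    using P best card_indicator_indices[OF \<open>1 \<le> L\<close> x0] by (intro bexI[of _ P]) auto
qed

end
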